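(* (i) Let $a,b>0$ be integers and let $f:\mathbb Z\to\mathbb Z$ be a non-decreasing map such that $f(x+a)=f(x)+b$ for all $x\in\mathbb Z$. Then there exists a unique map $f^t:\mathbb Z\to\mathbb Z$ such that $$f(x)\ge y\iff x\ge f^t(y)\qquad\forall x,y\in\mathbb Z.$$ Moreover $f^t$ is non-decreasing and satisfies $f^t(x+b)=f^t(x)+a$ for all $x\in\mathbb Z$. (ii) Let $h\in\mathrm{Hom}_\Lambda([n],[m])$. Then the class of $f^t$ is independent of the choice of $f\in h$ and defines an element $h^t\in\mathrm{Hom}_\Lambda([m],[n])$. (iii) The association $h\mapsto h^t$ defines a contravariant functor $\Lambda\to\Lambda$.
   Context: The cyclic category $\Lambda$ is described as follows: its objects are $[n]$, $n\ge0$; $\mathrm{Hom}_\Lambda([n],[m])$ is the set of equivalence classes of non-decreasing maps $f:\mathbb Z\to\mathbb Z$ satisfying $f(x+n+1)=f(x)+m+1$ for all $x\in\mathbb Z$, where $f\sim g$ if there is $j\in\mathbb Z$ with $g(x)=f(x)+j(m+1)$ for all $x$; composition is induced by composition of maps. The notation $f\in h$ means that the map $f$ represents the class $h$. *)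

theory Defs
  imports Main
begin

text \<open>Composition and morphism maps carry their objects as arguments, so hom-sets need not be
  disjoint. \<open>Comp C x y z g f\<close> is \<open>g\<close> after \<open>f\<close>, for \<open>f : x \<rightarrow> y\<close> and \<open>g : y \<rightarrow> z\<close>.\<close>

record ('o, 'm) category_data =
  Ob :: "'o set"
  Hom :: "'o \<Rightarrow> 'o \<Rightarrow> 'm set"
  Id :: "'o \<Rightarrow> 'm"
  Comp :: "'o \<Rightarrow> 'o \<Rightarrow> 'o \<Rightarrow> 'm \<Rightarrow> 'm \<Rightarrow> 'm"

locale category =
  fixes C :: "('o, 'm) category_data"
  assumes Id_in_Hom: "x \<in> Ob C \<Longrightarrow> Id C x \<in> Hom C x x"
    and Comp_in_Hom:
      "\<lbrakk>x \<in> Ob C; y \<in> Ob C; z \<in> Ob C; f \<in> Hom C x y; g \<in> Hom C y z\<rbrakk>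
        \<Longrightarrow> Comp C x y z g f \<in> Hom C x z"
    and Comp_Id_left:
      "\<lbrakk>x \<in> Ob C; y \<in> Ob C; f \<in> Hom C x y\<rbrakk> \<Longrightarrow> Comp C x y y (Id C y) f = f"
    and Comp_Id_right:
      "\<lbrakk>x \<in> Ob C; y \<in> Ob C; f \<in> Hom C x y\<rbrakk> \<Longrightarrow> Comp C x x y f (Id C x) = f"
    and Comp_assoc:
      "\<lbrakk>w \<in> Ob C; x \<in> Ob C; y \<in> Ob C; z \<in> Ob C;
        f \<in> Hom C w x; g \<in> Hom C x y; h \<in> Hom C y z\<rbrakk>
        \<Longrightarrow> Comp C w x z (Comp C x y z h g) f = Comp C w y z h (Comp C w x y g f)"

locale contravariant_functor = C: category C + D: category D
  for C :: "('o, 'm) category_data" and D :: "('p, 'n) category_data" +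
  fixes F_ob :: "'o \<Rightarrow> 'p" and F_hom :: "'o \<Rightarrow> 'o \<Rightarrow> 'm \<Rightarrow> 'n"
  assumes F_ob_in_Ob: "x \<in> Ob C \<Longrightarrow> F_ob x \<in> Ob D"
    and F_hom_in_Hom:
      "\<lbrakk>x \<in> Ob C; y \<in> Ob C; f \<in> Hom C x y\<rbrakk> \<Longrightarrow> F_hom x y f \<in> Hom D (F_ob y) (F_ob x)"
    and F_hom_Id: "x \<in> Ob C \<Longrightarrow> F_hom x x (Id C x) = Id D (F_ob x)"
    and F_hom_Comp:
      "\<lbrakk>x \<in> Ob C; y \<in> Ob C; z \<in> Ob C; f \<in> Hom C x y; g \<in> Hom C y z\<rbrakk>
        \<Longrightarrow> F_hom x z (Comp C x y z g f)
            = Comp D (F_ob z) (F_ob y) (F_ob x) (F_hom x y f) (F_hom y z g)"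

definition cyclic_maps :: "nat \<Rightarrow> nat \<Rightarrow> (int \<Rightarrow> int) set" where
  "cyclic_maps n m = {f. mono f \<and> (\<forall>x. f (x + int n + 1) = f x + int m + 1)}"

definition cyclic_rel :: "nat \<Rightarrow> nat \<Rightarrow> ((int \<Rightarrow> int) \<times> (int \<Rightarrow> int)) set" where
  "cyclic_rel n m = {(f, g). f \<in> cyclic_maps n m \<and> g \<in> cyclic_maps n m \<and>
     (\<exists>j. \<forall>x. g x = f x + j * (int m + 1))}"

definition cyclic_class :: "nat \<Rightarrow> nat \<Rightarrow> (int \<Rightarrow> int) \<Rightarrow> (int \<Rightarrow> int) set" where
  "cyclic_class n m f = cyclic_rel n m `` {f}"

text \<open>The operation induced on classes is, as usual for quotients, the union over all choices of
  representatives; it is a class exactly when the choices agree.\<close>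

definition cyclic_category :: "(nat, (int \<Rightarrow> int) set) category_data" where
  "cyclic_category = \<lparr>
     Ob = UNIV,
     Hom = (\<lambda>n m. cyclic_maps n m // cyclic_rel n m),
     Id = (\<lambda>n. cyclic_class n n id),
     Comp = (\<lambda>n m l k h. \<Union>g\<in>k. \<Union>f\<in>h. cyclic_class n l (g \<circ> f))\<rparr>"

definition transpose_map :: "(int \<Rightarrow> int) \<Rightarrow> (int \<Rightarrow> int)" where
  "transpose_map f = (THE t. \<forall>x y. f x \<ge> y \<longleftrightarrow> x \<ge> t y)"

definition transpose_class :: "nat \<Rightarrow> nat \<Rightarrow> (int \<Rightarrow> int) set \<Rightarrow> (int \<Rightarrow> int) set" where
  "transpose_class n m h = (\<Union>f\<in>h. cyclic_class m n (transpose_map f))"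

end

theory Submission
  imports Defs
begin

text \<open>The map \<open>f\<^sup>t\<close> is the lower adjoint of \<open>f\<close> for the order of the integers. It exists because a
  quasi-periodic map is unbounded in both directions, and its shift rule is the adjoint of the
  shift rule of \<open>f\<close>. Functoriality is the uniqueness of adjoints together with the fact that the
  adjoint of a composite is the composite of the adjoints in the reverse order.\<close>

section \<open>Lower adjoints of quasi-periodic maps of the integers\<close>

lemma quasi_periodic_multiple:
  fixes f :: "int \<Rightarrow> int"
  assumes "\<forall>x. f (x + a) = f x + b"
  shows "f (x + k * a) = f x + k * b"
proof (induction k rule: int_induct[where k = 0])
  case (step1 i)
  then show ?case
    using spec[OF assms, of "x + i * a"] by (simp add: algebra_simps)
next
  case (step2 i)
  then show ?case
    using spec[OF assms, of "x + (i - 1) * a"] by (simp add: algebra_simps)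
qed simp

text \<open>For fixed \<open>y\<close>, monotonicity makes the solutions \<open>x\<close> of
  \<open>y\<close> \<le> \<open>f x\<close> an up-set. Quasi-periodicity makes this set nonempty and
  bounded below, so its least element can serve as \<open>t y\<close>.\<close>

lemma adjoint_exists:
  fixes f :: "int \<Rightarrow> int"
  assumes "b > 0" "mono f" and shift: "\<forall>x. f (x + a) = f x + b"
  shows "\<exists>t :: int \<Rightarrow> int. \<forall>x y. f x \<ge> y \<longleftrightarrow> x \<ge> t y"
proof -
  have "\<exists>s. \<forall>x. f x \<ge> y \<longleftrightarrow> x \<ge> s" for y
  proof -
    \<comment> \<open>Since \<open>b\<close> is at least 1, \<open>k * b\<close> exceeds the
      distance from \<open>f 0\<close> to \<open>y\<close>. Hence \<open>k\<close> shifts one way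
      lift \<open>f\<close> to \<open>y\<close> or above, and \<open>k\<close> shifts the other way
      push it strictly below \<open>y\<close>.\<close>
    define k where "k = \<bar>y - f 0\<bar> + 1"
    have k: "k * b \<ge> k"
      using \<open>b > 0\<close> mult_left_mono[of 1 b k] by (simp add: k_def)
    have "f (k * a) = f 0 + k * b" "f (- (k * a)) = f 0 - k * b"
      using quasi_periodic_multiple[OF shift, of 0 k] quasi_periodic_multiple[OF shift, of 0 "- k"]
      by simp_all
    then have upper: "f (k * a) \<ge> y" and lower: "f (- (k * a)) < y"
      using k unfolding k_def by linarith+
    \<comment> \<open>\<open>Min\<close> needs a finite set, so the solutions are cut down to a
      window. Nothing at or below its left end is a solution, and its right end is one.\<close>
    define S where "S = {x \<in> {- (k * a)..k * a}. f x \<ge> y}"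
    have bound: "x > - (k * a)" if "f x \<ge> y" for x
      using monoD[OF \<open>mono f\<close>, of x "- (k * a)"] lower that by force
    have "finite S"
      by (rule finite_subset[of _ "{- (k * a)..k * a}"]) (auto simp: S_def)
    \<comment> \<open>That the window is not empty is read off from \<open>bound\<close> at
      \<open>k * a\<close>.\<close>
    moreover have "k * a \<in> S"
      using upper bound[OF upper] by (simp add: S_def)
    ultimately have S: "finite S" "k * a \<in> S" .
    have "f x \<ge> y \<longleftrightarrow> x \<ge> Min S" for x
    proof
      assume "f x \<ge> y"
      show "x \<ge> Min S"
      proof (cases "x \<le> k * a")
        case True
        then have "x \<in> S" using bound[OF \<open>f x \<ge> y\<close>] \<open>f x \<ge> y\<close> by (simp add: S_def)
        then show ?thesis using S by simp
      next
        case False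
        then show ?thesis using Min_le[OF S] by linarith
      qed
    next
      assume "x \<ge> Min S"
      moreover have "Min S \<in> S"
        using S by (intro Min_in) auto
      ultimately show "f x \<ge> y"
        using monoD[OF \<open>mono f\<close>, of "Min S" x] by (simp add: S_def)
    qed
    then show ?thesis by blast
  qed
  then show ?thesis by metis
qed

text \<open>Both values at \<open>y\<close> are the least \<open>x\<close> with \<open>y\<close>
  \<le> \<open>f x\<close>.\<close>

lemma adjoint_unique:
  fixes f s t :: "int \<Rightarrow> int"
  assumes "\<forall>x y. f x \<ge> y \<longleftrightarrow> x \<ge> s y" "\<forall>x y. f x \<ge> y \<longleftrightarrow> x \<ge> t y"
  shows "s = t"
proof
  fix y
  show "s y = t y" using assms by (meson order_antisym order_refl)
qed

text \<open>The working tool for computing transposes: identities, composites and translates are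
  handled by exhibiting a map that satisfies the adjunction.\<close>

lemma transpose_map_eqI:
  assumes "\<forall>x y. f x \<ge> y \<longleftrightarrow> x \<ge> t y"
  shows "transpose_map f = t"
  unfolding transpose_map_def using assms adjoint_unique[OF _ assms] by (rule the_equality)

lemma transpose_map_adjoint:
  assumes "b > 0" "mono f" "\<forall>x. f (x + a) = f x + b"
  shows "f x \<ge> y \<longleftrightarrow> x \<ge> transpose_map f y"
  using adjoint_exists[OF assms] transpose_map_eqI by metis

text \<open>If \<open>y\<close> \<le> \<open>z\<close>, then \<open>z\<close> \<le>
  \<open>f (transpose_map f z)\<close> gives \<open>y\<close> \<le>
  \<open>f (transpose_map f z)\<close>, and the adjunction turns this into the claim.\<close>

lemma mono_transpose_map:
  assumes "b > 0" "mono f" "\<forall>x. f (x + a) = f x + b"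
  shows "mono (transpose_map f)"
  using transpose_map_adjoint[OF assms] by (meson monoI order_refl order_trans)

lemma transpose_map_shift:
  assumes "b > 0" "mono f" "\<forall>x. f (x + a) = f x + b"
  shows "transpose_map f (y + b) = transpose_map f y + a"
proof -
  \<comment> \<open>The condition \<open>y + b\<close> \<le> \<open>f x\<close> says
    \<open>y\<close> \<le> \<open>f (x - a)\<close>. The two integers thus have the same upper
    bounds and agree.\<close>
  have "transpose_map f (y + b) \<le> x \<longleftrightarrow> transpose_map f y + a \<le> x" for x
    using transpose_map_adjoint[OF assms, of "y + b" x]
      transpose_map_adjoint[OF assms, of y "x - a"] spec[OF assms(3), of "x - a"]
    by (simp add: le_diff_eq)
  then show ?thesis by (meson order_antisym order_refl)
qed

section \<open>Cyclic maps, as the case of periods \<open>int n + 1\<close> and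
  \<open>int m + 1\<close>\<close>

lemma cyclic_maps_iff:
  "f \<in> cyclic_maps n m \<longleftrightarrow> mono f \<and> (\<forall>x. f (x + (int n + 1)) = f x + (int m + 1))"
  by (simp add: cyclic_maps_def add.assoc)

lemma cyclic_maps_shift:
  assumes "f \<in> cyclic_maps n m"
  shows "f (x + j * (int n + 1)) = f x + j * (int m + 1)"
  using assms quasi_periodic_multiple by (simp add: cyclic_maps_iff)

lemma id_in_cyclic_maps: "id \<in> cyclic_maps n n"
  by (simp add: cyclic_maps_iff mono_def)

lemma comp_in_cyclic_maps:
  assumes "f \<in> cyclic_maps n m" "g \<in> cyclic_maps m l"
  shows "g \<circ> f \<in> cyclic_maps n l"
  using assms by (auto simp: cyclic_maps_iff mono_def)

lemma cyclic_maps_adjoint: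
  assumes "f \<in> cyclic_maps n m"
  shows "f x \<ge> y \<longleftrightarrow> x \<ge> transpose_map f y"
  using assms by (intro transpose_map_adjoint[where a = "int n + 1" and b = "int m + 1"])
    (simp_all add: cyclic_maps_iff)

lemma transpose_map_in_cyclic_maps:
  assumes "f \<in> cyclic_maps n m"
  shows "transpose_map f \<in> cyclic_maps m n"
proof -
  have "int m + 1 > 0" "mono f" "\<forall>x. f (x + (int n + 1)) = f x + (int m + 1)"
    using assms by (simp_all add: cyclic_maps_iff)
  note f = this
  show ?thesis
    using mono_transpose_map[OF f] transpose_map_shift[OF f] by (simp add: cyclic_maps_iff)
qed

lemma transpose_map_id: "transpose_map id = id"
  by (rule transpose_map_eqI) simp

text \<open>Two adjunctions are chained: \<open>g\<close> is moved across the inequality first and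
  \<open>f\<close> second, which reverses the order.\<close>

lemma transpose_map_comp:
  assumes "f \<in> cyclic_maps n m" "g \<in> cyclic_maps m l"
  shows "transpose_map (g \<circ> f) = transpose_map f \<circ> transpose_map g"
  by (rule transpose_map_eqI)
    (simp add: cyclic_maps_adjoint[OF assms(1)] cyclic_maps_adjoint[OF assms(2)])

section \<open>Classes of cyclic maps and their composition\<close>

lemma cyclic_relE:
  assumes "(f, g) \<in> cyclic_rel n m"
  obtains j where "f \<in> cyclic_maps n m" "g \<in> cyclic_maps n m" "\<forall>x. g x = f x + j * (int m + 1)"
  using assms by (auto simp: cyclic_rel_def)

lemma cyclic_relI:
  assumes "f \<in> cyclic_maps n m" "g \<in> cyclic_maps n m" "\<forall>x. g x = f x + j * (int m + 1)"
  shows "(f, g) \<in> cyclic_rel n m"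
  using assms by (auto simp: cyclic_rel_def)

lemma equiv_cyclic_rel: "equiv (cyclic_maps n m) (cyclic_rel n m)"
proof (rule equivI)
  show "cyclic_rel n m \<subseteq> cyclic_maps n m \<times> cyclic_maps n m"
    by (auto simp: cyclic_rel_def)
  show "refl_on (cyclic_maps n m) (cyclic_rel n m)"
    by (auto intro!: refl_onI cyclic_relI[where j = 0])
  show "sym (cyclic_rel n m)"
  proof (rule symI)
    fix f g assume "(f, g) \<in> cyclic_rel n m"
    then obtain j where "f \<in> cyclic_maps n m" "g \<in> cyclic_maps n m"
      "\<forall>x. g x = f x + j * (int m + 1)" by (rule cyclic_relE)
    then show "(g, f) \<in> cyclic_rel n m"
      by (intro cyclic_relI[where j = "- j"]) (simp_all add: algebra_simps)
  qed
  show "trans (cyclic_rel n m)"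
  proof (rule transI)
    fix f g h assume "(f, g) \<in> cyclic_rel n m" "(g, h) \<in> cyclic_rel n m"
    then obtain i j where "f \<in> cyclic_maps n m" "h \<in> cyclic_maps n m"
      "\<forall>x. g x = f x + i * (int m + 1)" "\<forall>x. h x = g x + j * (int m + 1)"
      by (metis cyclic_relE)
    then show "(f, h) \<in> cyclic_rel n m"
      by (intro cyclic_relI[where j = "i + j"]) (simp_all add: algebra_simps)
  qed
qed

lemma cyclic_class_eqI: "(f, g) \<in> cyclic_rel n m \<Longrightarrow> cyclic_class n m f = cyclic_class n m g"
  unfolding cyclic_class_def by (rule equiv_class_eq[OF equiv_cyclic_rel])

lemma in_cyclic_class: "g \<in> cyclic_class n m f \<longleftrightarrow> (f, g) \<in> cyclic_rel n m"
  by (simp add: cyclic_class_def)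

lemma self_in_cyclic_class: "f \<in> cyclic_maps n m \<Longrightarrow> f \<in> cyclic_class n m f"
  unfolding cyclic_class_def by (rule equiv_class_self[OF equiv_cyclic_rel])

lemma Id_cyclic_category: "Id cyclic_category n = cyclic_class n n id"
  by (simp add: cyclic_category_def)

lemma cyclic_class_in_Hom:
  "f \<in> cyclic_maps n m \<Longrightarrow> cyclic_class n m f \<in> Hom cyclic_category n m"
  by (simp add: cyclic_category_def cyclic_class_def quotientI)

lemma Hom_cyclic_categoryE:
  assumes "h \<in> Hom cyclic_category n m"
  obtains f where "f \<in> cyclic_maps n m" "h = cyclic_class n m f"
  using assms by (auto simp: cyclic_category_def cyclic_class_def elim: quotientE)

text \<open>A translation of \<open>f\<close> by \<open>i\<close> periods passes through
  \<open>g\<close> as a translation by \<open>i\<close> periods of the target, so the two offsets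
  add.\<close>

lemma cyclic_rel_comp:
  assumes "(f, f') \<in> cyclic_rel n m" "(g, g') \<in> cyclic_rel m l"
  shows "(g \<circ> f, g' \<circ> f') \<in> cyclic_rel n l"
proof -
  obtain i where f: "f \<in> cyclic_maps n m" "f' \<in> cyclic_maps n m"
    "\<forall>x. f' x = f x + i * (int m + 1)" using assms(1) by (rule cyclic_relE)
  obtain j where g: "g \<in> cyclic_maps m l" "g' \<in> cyclic_maps m l"
    "\<forall>x. g' x = g x + j * (int l + 1)" using assms(2) by (rule cyclic_relE)
  show ?thesis
    using f g cyclic_maps_shift[OF g(1)]
    by (intro cyclic_relI[where j = "i + j"] comp_in_cyclic_maps) (simp_all add: distrib_right)
qed

text \<open>Each union runs over a constant family, as related factors have related composites. Its
  index set is nonempty because a class contains its representative.\<close>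

lemma Comp_cyclic_class:
  assumes "f \<in> cyclic_maps n m" "g \<in> cyclic_maps m l"
  shows "Comp cyclic_category n m l (cyclic_class m l g) (cyclic_class n m f)
    = cyclic_class n l (g \<circ> f)"
proof -
  have "(\<Union>f'\<in>cyclic_class n m f. cyclic_class n l (g' \<circ> f')) = cyclic_class n l (g \<circ> f)"
    if "g' \<in> cyclic_class m l g" for g'
    using that cyclic_class_eqI[OF cyclic_rel_comp]
    by (intro UN_constant_eq[OF self_in_cyclic_class[OF assms(1)]]) (auto simp: in_cyclic_class)
  then have "(\<Union>g'\<in>cyclic_class m l g. \<Union>f'\<in>cyclic_class n m f. cyclic_class n l (g' \<circ> f'))
      = cyclic_class n l (g \<circ> f)"
    by (intro UN_constant_eq[OF self_in_cyclic_class[OF assms(2)]]) blast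
  then show ?thesis by (simp add: cyclic_category_def)
qed

section \<open>Transposition on classes\<close>

lemma cyclic_rel_transpose:
  assumes "(f, g) \<in> cyclic_rel n m"
  shows "(transpose_map f, transpose_map g) \<in> cyclic_rel m n"
proof -
  obtain j where f: "f \<in> cyclic_maps n m" and g: "g \<in> cyclic_maps n m"
    and gf: "\<forall>x. g x = f x + j * (int m + 1)" using assms by (rule cyclic_relE)
  note ft = transpose_map_in_cyclic_maps[OF f]
  \<comment> \<open>The offset of \<open>g\<close> is moved to the side of \<open>y\<close>, which
    flips its sign. The shift rule of \<open>transpose_map f\<close> then converts periods
    \<open>int m + 1\<close> into periods \<open>int n + 1\<close>.\<close>
  have "g x \<ge> y \<longleftrightarrow> x \<ge> transpose_map f y + - j * (int n + 1)" for x y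
    using cyclic_maps_adjoint[OF f, of "y + - j * (int m + 1)" x] cyclic_maps_shift[OF ft, of y "- j"]
    by (simp add: gf diff_le_eq)
  then have "transpose_map g = (\<lambda>y. transpose_map f y + - j * (int n + 1))"
    by (intro transpose_map_eqI) blast
  then show ?thesis
    using ft transpose_map_in_cyclic_maps[OF g] by (intro cyclic_relI[where j = "- j"]) simp_all
qed

text \<open>Again a union over a nonempty constant family. This reduces statements about classes to
  statements about representatives.\<close>

lemma transpose_class_eq:
  assumes "f \<in> cyclic_maps n m"
  shows "transpose_class n m (cyclic_class n m f) = cyclic_class m n (transpose_map f)"
  unfolding transpose_class_def
  using cyclic_class_eqI[OF cyclic_rel_transpose]
  by (intro UN_constant_eq[OF self_in_cyclic_class[OF assms]]) (auto simp: in_cyclic_class)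

lemma transpose_class_in_Hom:
  assumes "h \<in> Hom cyclic_category n m"
  shows "transpose_class n m h \<in> Hom cyclic_category m n"
  using assms
  by (metis Hom_cyclic_categoryE transpose_class_eq transpose_map_in_cyclic_maps cyclic_class_in_Hom)

lemma transpose_class_representative:
  assumes "h \<in> Hom cyclic_category n m" "f \<in> h"
  shows "transpose_class n m h = cyclic_class m n (transpose_map f)"
proof -
  obtain g where g: "h = cyclic_class n m g" using assms(1) by (rule Hom_cyclic_categoryE)
  then have "(g, f) \<in> cyclic_rel n m" using assms(2) by (simp add: in_cyclic_class)
  moreover from this have "f \<in> cyclic_maps n m" by (rule cyclic_relE)
  ultimately show ?thesis using transpose_class_eq cyclic_class_eqI g by metis
qed

section \<open>The cyclic category and the transposition functor\<close>

lemma category_cyclic: "category cyclic_category"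
proof
  fix x show "Id cyclic_category x \<in> Hom cyclic_category x x"
    by (simp add: Id_cyclic_category cyclic_class_in_Hom id_in_cyclic_maps)
next
  \<comment> \<open>Here and in the remaining axioms, choosing representatives leaves the
    corresponding law for composition of maps.\<close>
  fix x y z f g assume "f \<in> Hom cyclic_category x y" "g \<in> Hom cyclic_category y z"
  then show "Comp cyclic_category x y z g f \<in> Hom cyclic_category x z"
    by (elim Hom_cyclic_categoryE)
      (simp add: Comp_cyclic_class comp_in_cyclic_maps cyclic_class_in_Hom)
next
  fix x y f assume f: "f \<in> Hom cyclic_category x y"
  then show "Comp cyclic_category x y y (Id cyclic_category y) f = f"
    by (elim Hom_cyclic_categoryE)
      (simp add: Id_cyclic_category Comp_cyclic_class id_in_cyclic_maps)
  from f show "Comp cyclic_category x x y f (Id cyclic_category x) = f"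
    by (elim Hom_cyclic_categoryE)
      (simp add: Id_cyclic_category Comp_cyclic_class id_in_cyclic_maps)
next
  fix w x y z f g h
  assume "f \<in> Hom cyclic_category w x" "g \<in> Hom cyclic_category x y" "h \<in> Hom cyclic_category y z"
  then show "Comp cyclic_category w x z (Comp cyclic_category x y z h g) f
      = Comp cyclic_category w y z h (Comp cyclic_category w x y g f)"
    by (elim Hom_cyclic_categoryE) (simp add: Comp_cyclic_class comp_in_cyclic_maps comp_assoc)
qed

lemma contravariant_functor_transpose:
  "contravariant_functor cyclic_category cyclic_category (\<lambda>n. n) transpose_class"
proof (intro contravariant_functor.intro category_cyclic contravariant_functor_axioms.intro)
  fix x show "transpose_class x x (Id cyclic_category x) = Id cyclic_category x"
    by (simp add: Id_cyclic_category transpose_class_eq id_in_cyclic_maps transpose_map_id)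
next
  fix x y z f g assume "f \<in> Hom cyclic_category x y" "g \<in> Hom cyclic_category y z"
  \<comment> \<open>On representatives, both sides are the class of \<open>transpose_map f\<close>
    after \<open>transpose_map g\<close>.\<close>
  then show "transpose_class x z (Comp cyclic_category x y z g f)
      = Comp cyclic_category z y x (transpose_class x y f) (transpose_class y z g)"
    by (elim Hom_cyclic_categoryE)
      (simp add: Comp_cyclic_class comp_in_cyclic_maps transpose_class_eq transpose_map_comp
        transpose_map_in_cyclic_maps)
qed (simp_all add: transpose_class_in_Hom)

theorem proposition4p1:
  shows
    "(\<forall>(a::int) (b::int) (f :: int \<Rightarrow> int).
        a > 0 \<longrightarrow> b > 0 \<longrightarrow> mono f \<longrightarrow> (\<forall>x. f (x + a) = f x + b) \<longrightarrow>
          (\<exists>!t :: int \<Rightarrow> int. \<forall>x y. f x \<ge> y \<longleftrightarrow> x \<ge> t y) \<and>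
          (\<forall>x y. f x \<ge> y \<longleftrightarrow> x \<ge> transpose_map f y) \<and>
          mono (transpose_map f) \<and>
          (\<forall>x. transpose_map f (x + b) = transpose_map f x + a))
     \<and> (\<forall>n m. \<forall>h \<in> Hom cyclic_category n m.
          (\<forall>f \<in> h. \<forall>g \<in> h.
             cyclic_class m n (transpose_map f) = cyclic_class m n (transpose_map g)) \<and>
          (\<forall>f \<in> h. transpose_class n m h = cyclic_class m n (transpose_map f)) \<and>
          transpose_class n m h \<in> Hom cyclic_category m n)
     \<and> contravariant_functor cyclic_category cyclic_category (\<lambda>n. n) transpose_class"
proof (intro conjI allI ballI impI)
  fix a b :: int and f :: "int \<Rightarrow> int"
  assume "b > 0" "mono f" "\<forall>x. f (x + a) = f x + b"
  note f = this
  show "\<exists>!t :: int \<Rightarrow> int. \<forall>x y. f x \<ge> y \<longleftrightarrow> x \<ge> t y"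
    using adjoint_exists[OF f] adjoint_unique by (rule ex_ex1I)
  show "mono (transpose_map f)"
    using f by (rule mono_transpose_map)
  fix x y
  show "f x \<ge> y \<longleftrightarrow> x \<ge> transpose_map f y"
    using f by (rule transpose_map_adjoint)
  show "transpose_map f (x + b) = transpose_map f x + a"
    using f by (rule transpose_map_shift)
next
  fix n m h assume h: "h \<in> Hom cyclic_category n m"
  then show "transpose_class n m h \<in> Hom cyclic_category m n"
    by (rule transpose_class_in_Hom)
  fix f assume "f \<in> h"
  then show f: "transpose_class n m h = cyclic_class m n (transpose_map f)"
    using h by (intro transpose_class_representative)
  \<comment> \<open>Independence of the representative: both classes equal
    \<open>transpose_class n m h\<close>.\<close>
  fix g assume "g \<in> h"
  then show "cyclic_class m n (transpose_map f) = cyclic_class m n (transpose_map g)"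
    using transpose_class_representative[OF h] f by metis
qed (rule contravariant_functor_transpose)

end
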